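(* For $k\ge 4$, the fan $F_k$ has weight $w(F_k)=\frac{k+1}{4}$.
   Context: The fan $F_k$ is the path $P_k$ on $k$ vertices together with an additional vertex adjacent to every vertex of the path. A pebbling distribution assigns to each vertex $v$ a non-negative integer $D(v)$ of pebbles; a rooted distribution fixes a root $r$. A pebbling step $[a,b]$, for adjacent $a,b$, removes two pebbles from $a$ and adds one to $b$. A rooted distribution is $r$-solvable if some sequence of pebbling steps ends with at least one pebble on $r$; it is $r$-critical if it is $r$-solvable but removing any single pebble makes it not $r$-solvable. $c_r(G)$ is the largest size of an $r$-critical rooted distribution on $G$ over all roots; an $r$-ceiling distribution is an $r$-critical rooted distribution with exactly $c_r(G)$ pebbles. The weight of a rooted distribution is $w(D)=\sum_v D(v)/2^{d(v,r)}$ ($d$ = graph distance), and $w(G)$ is the largest weight of an $r$-ceiling distribution on $G$. *)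

theory Defs
  imports Complex_Main
begin

text \<open>A simple graph is a vertex set together with a set of two-element sets of vertices.\<close>

type_synonym 'a graph = "'a set \<times> 'a set set"

definition verts :: "'a graph \<Rightarrow> 'a set" where
  "verts G = fst G"

definition edges :: "'a graph \<Rightarrow> 'a set set" where
  "edges G = snd G"

definition adj_rel :: "'a graph \<Rightarrow> ('a \<times> 'a) set" where
  "adj_rel G = {(a, b). a \<noteq> b \<and> {a, b} \<in> edges G}"

text \<open>Meaningful for vertices in the same component only.\<close>

definition graph_dist :: "'a graph \<Rightarrow> 'a \<Rightarrow> 'a \<Rightarrow> nat" where
  "graph_dist G u v = (LEAST n. (u, v) \<in> adj_rel G ^^ n)"

definition path_graph :: "nat \<Rightarrow> nat graph" where
  "path_graph k = ({..<k}, {{i, Suc i} | i. Suc i < k})"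

text \<open>The cone adds one vertex, \<open>None\<close>, adjacent to every vertex of the given graph.\<close>

definition cone :: "'a graph \<Rightarrow> 'a option graph" where
  "cone G = (insert None (Some ` verts G),
             (`) Some ` edges G \<union> {{None, Some v} | v. v \<in> verts G})"

definition fan :: "nat \<Rightarrow> nat option graph" where
  "fan k = cone (path_graph k)"

definition distribution :: "'a graph \<Rightarrow> ('a \<Rightarrow> nat) \<Rightarrow> bool" where
  "distribution G D \<longleftrightarrow> (\<forall>v. v \<notin> verts G \<longrightarrow> D v = 0)"

definition dist_size :: "'a graph \<Rightarrow> ('a \<Rightarrow> nat) \<Rightarrow> nat" where
  "dist_size G D = (\<Sum>v\<in>verts G. D v)"

definition pebbling_step :: "'a graph \<Rightarrow> ('a \<Rightarrow> nat) \<Rightarrow> ('a \<Rightarrow> nat) \<Rightarrow> bool" where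
  "pebbling_step G D D' \<longleftrightarrow>
     (\<exists>a b. (a, b) \<in> adj_rel G \<and> 2 \<le> D a \<and> D' = D(a := D a - 2, b := D b + 1))"

definition solvable :: "'a graph \<Rightarrow> 'a \<Rightarrow> ('a \<Rightarrow> nat) \<Rightarrow> bool" where
  "solvable G r D \<longleftrightarrow> (\<exists>D'. (pebbling_step G)\<^sup>*\<^sup>* D D' \<and> 1 \<le> D' r)"

definition critical :: "'a graph \<Rightarrow> 'a \<Rightarrow> ('a \<Rightarrow> nat) \<Rightarrow> bool" where
  "critical G r D \<longleftrightarrow>
     r \<in> verts G \<and> distribution G D \<and> solvable G r D \<and>
     (\<forall>v. 0 < D v \<longrightarrow> \<not> solvable G r (D(v := D v - 1)))"

text \<open>
  On a finite nonempty graph there are only finitely many critical rooted distributions: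
  for a fixed root, the critical distributions are the minimal elements of the set of solvable
  ones under the pointwise order, hence form an antichain (Dickson's lemma). So both
  maxima below are taken over finite nonempty sets.
\<close>

definition critical_number :: "'a graph \<Rightarrow> nat" where
  "critical_number G = Max {dist_size G D | r D. critical G r D}"

definition ceiling_distribution :: "'a graph \<Rightarrow> 'a \<Rightarrow> ('a \<Rightarrow> nat) \<Rightarrow> bool" where
  "ceiling_distribution G r D \<longleftrightarrow> critical G r D \<and> dist_size G D = critical_number G"

definition weight :: "'a graph \<Rightarrow> 'a \<Rightarrow> ('a \<Rightarrow> nat) \<Rightarrow> real" where
  "weight G r D = (\<Sum>v\<in>verts G. real (D v) / 2 ^ graph_dist G v r)"

definition graph_weight :: "'a graph \<Rightarrow> real" where
  "graph_weight G = Max {weight G r D | r D. ceiling_distribution G r D}"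

end

theory Submission
  imports Defs
begin

text \<open>
  A critical distribution is a minimal solvable one, so exhibiting a solvable distribution below it
  determines it completely. If the root is a path vertex, then two pebbles on a neighbour of the
  root, one pebble on the hub together with a pile of two, four pebbles on a vertex, or two piles of
  two are each solvable, and these give small critical distributions of weight one. Otherwise the
  hub is empty and there is a single pile, of two or three pebbles, on the path. The hub can then
  never collect two pebbles, and a pebble can travel along the path only through occupied vertices;
  hence the distribution is a pile of two followed by a run of single pebbles up to the root.
  The longest such run, of size \<open>k\<close>, starts at one end of the path and leads to the other.
\<close>

section \<open>Solvable and critical distributions\<close>

lemma solvable_rootI: "1 \<le> D r \<Longrightarrow> solvable G r D"
  unfolding solvable_def by blast

lemma solvable_stepI:
  assumes "(a, b) \<in> adj_rel G" "2 \<le> D a" "solvable G r (D(a := D a - 2, b := D b + 1))"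
  shows "solvable G r D"
proof -
  have "pebbling_step G D (D(a := D a - 2, b := D b + 1))"
    using assms(1,2) unfolding pebbling_step_def by blast
  with assms(3) show ?thesis
    unfolding solvable_def by (blast intro: converse_rtranclp_into_rtranclp)
qed

lemma pebbling_step_mono:
  assumes "pebbling_step G D D'" "D \<le> E"
  shows "\<exists>E'. pebbling_step G E E' \<and> D' \<le> E'"
proof -
  obtain a b where ab: "(a, b) \<in> adj_rel G" "2 \<le> D a" "D' = D(a := D a - 2, b := D b + 1)"
    using assms(1) unfolding pebbling_step_def by blast
  have le: "D x \<le> E x" for x
    using assms(2) by (simp add: le_fun_def)
  have "pebbling_step G E (E(a := E a - 2, b := E b + 1))"
    using ab(1) order_trans[OF ab(2) le[of a]] unfolding pebbling_step_def by blast
  moreover have "D' \<le> E(a := E a - 2, b := E b + 1)"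
    unfolding ab(3) le_fun_def using le by (simp add: diff_le_mono)
  ultimately show ?thesis by blast
qed

text \<open>Extra pebbles never block a step, so a sequence of steps from \<open>D\<close> can be
  replayed from \<open>E\<close> while staying pointwise above it.\<close>

lemma solvable_mono:
  assumes "solvable G r D" "D \<le> E"
  shows "solvable G r E"
proof -
  obtain D' where "(pebbling_step G)\<^sup>*\<^sup>* D D'" and r: "1 \<le> D' r"
    using assms(1) unfolding solvable_def by blast
  from this(1) have "\<exists>E'. (pebbling_step G)\<^sup>*\<^sup>* E E' \<and> D' \<le> E'"
  proof (induction rule: rtranclp_induct)
    case base
    show ?case using assms(2) by blast
  next
    case (step y z)
    then obtain E' where E': "(pebbling_step G)\<^sup>*\<^sup>* E E'" "y \<le> E'" by blast
    obtain E'' where "pebbling_step G E' E''" "z \<le> E''"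
      using pebbling_step_mono[OF step.hyps(2) E'(2)] by blast
    with E'(1) show ?case by (blast intro: rtranclp.rtrancl_into_rtrancl)
  qed
  then obtain E' where "(pebbling_step G)\<^sup>*\<^sup>* E E'" "D' \<le> E'" by blast
  moreover from this(2) have "1 \<le> E' r" using order_trans[OF r] by (simp add: le_fun_def)
  ultimately show ?thesis unfolding solvable_def by blast
qed

text \<open>If \<open>E\<close> were smaller than \<open>D\<close> at some \<open>v\<close>, it
  would still lie below \<open>D\<close> with one pebble taken from \<open>v\<close>, and that
  distribution would be solvable by monotonicity.\<close>

lemma critical_minimal:
  assumes "critical G r D" "solvable G r E" "E \<le> D"
  shows "D = E"
proof (rule ccontr)
  assume "D \<noteq> E"
  then obtain v where v: "D v \<noteq> E v" by (auto simp: fun_eq_iff)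
  have le: "E x \<le> D x" for x using assms(3) by (simp add: le_fun_def)
  have "E v < D v" using v le[of v] by simp
  then have pos: "0 < D v" and "E v \<le> D v - 1" by linarith+
  then have "E \<le> D(v := D v - 1)" by (simp add: le_fun_def le)
  with assms(2) have "solvable G r (D(v := D v - 1))" by (rule solvable_mono)
  moreover have "\<not> solvable G r (D(v := D v - 1))"
    using assms(1) pos by (simp add: critical_def)
  ultimately show False by contradiction
qed

text \<open>Every step needs a vertex with two pebbles, so nothing can move and the root stays
  empty.\<close>

lemma not_solvable_of_le_one:
  assumes "\<And>v. D v \<le> 1" "D r = 0"
  shows "\<not> solvable G r D"
proof
  assume "solvable G r D"
  then obtain D' where D': "(pebbling_step G)\<^sup>*\<^sup>* D D'" "1 \<le> D' r"
    unfolding solvable_def by blast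
  have "\<not> pebbling_step G D E" for E
    unfolding pebbling_step_def by (metis assms(1) not_less_eq_eq numeral_2_eq_2 One_nat_def)
  with D'(1) have "D' = D"
    by (metis converse_rtranclpE)
  with D'(2) assms(2) show False by simp
qed

section \<open>Computing sizes, weights and distances\<close>

lemma dist_size_fun_upd:
  assumes "finite (verts G)" "v \<in> verts G" "D v = 0"
  shows "dist_size G (D(v := c)) = dist_size G D + c"
proof -
  have "(\<Sum>x\<in>verts G - {v}. (D(v := c)) x) = (\<Sum>x\<in>verts G - {v}. D x)"
    by (intro sum.cong) auto
  then show ?thesis
    using assms unfolding dist_size_def by (simp add: sum.remove[of _ v])
qed

lemma weight_fun_upd:
  assumes "finite (verts G)" "v \<in> verts G" "D v = 0"
  shows "weight G r (D(v := c)) = weight G r D + real c / 2 ^ graph_dist G v r"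
proof -
  have "(\<Sum>x\<in>verts G - {v}. real ((D(v := c)) x) / 2 ^ graph_dist G x r)
      = (\<Sum>x\<in>verts G - {v}. real (D x) / 2 ^ graph_dist G x r)"
    by (intro sum.cong) auto
  then show ?thesis
    using assms unfolding weight_def by (simp add: sum.remove[of _ v])
qed

lemma dist_size_zero: "dist_size G (\<lambda>_. 0) = 0"
  by (simp add: dist_size_def)

lemma weight_zero: "weight G r (\<lambda>_. 0) = 0"
  by (simp add: weight_def)

lemma graph_dist_self: "graph_dist G v v = 0"
  unfolding graph_dist_def by (rule Least_eq_0) simp

lemma graph_dist_eq_1:
  assumes "(u, v) \<in> adj_rel G"
  shows "graph_dist G u v = 1"
  unfolding graph_dist_def
proof (rule Least_equality)
  show "(u, v) \<in> adj_rel G ^^ 1" using assms by simp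
  have "u \<noteq> v" using assms by (simp add: adj_rel_def)
  then show "1 \<le> n" if "(u, v) \<in> adj_rel G ^^ n" for n
    using that by (cases n) auto
qed

lemma graph_dist_eq_2:
  assumes "(u, w) \<in> adj_rel G" "(w, v) \<in> adj_rel G" "(u, v) \<notin> adj_rel G" "u \<noteq> v"
  shows "graph_dist G u v = 2"
  unfolding graph_dist_def
proof (rule Least_equality)
  show "(u, v) \<in> adj_rel G ^^ 2" using assms by (auto simp: numeral_2_eq_2)
  show "2 \<le> n" if n: "(u, v) \<in> adj_rel G ^^ n" for n
  proof (rule ccontr)
    assume "\<not> 2 \<le> n"
    then have "n = 0 \<or> n = 1" by linarith
    then show False using n assms(3,4) by auto
  qed
qed

section \<open>The fan\<close>

lemma verts_fan: "verts (fan k) = insert None (Some ` {..<k})"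
  by (simp add: fan_def cone_def path_graph_def verts_def)

lemma finite_verts_fan: "finite (verts (fan k))"
  by (simp add: verts_fan)

lemma sum_verts_fan: "(\<Sum>v\<in>verts (fan k). f v) = f None + (\<Sum>i<k. f (Some i))"
  by (simp add: verts_fan sum.reindex)

lemma edges_fan:
  "edges (fan k) = {{Some i, Some (Suc i)} | i. Suc i < k} \<union> {{None, Some i} | i. i < k}"
proof -
  have "(`) Some ` {{i, Suc i} | i. Suc i < k} = {{Some i, Some (Suc i)} | i. Suc i < k}"
    by (simp add: setcompr_eq_image image_image)
  then show ?thesis
    by (simp add: fan_def cone_def path_graph_def verts_def edges_def)
qed

lemma adj_fan_None_Some: "(None, Some i) \<in> adj_rel (fan k) \<longleftrightarrow> i < k"
  by (auto simp: adj_rel_def edges_fan doubleton_eq_iff)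

lemma adj_fan_Some_None: "(Some i, None) \<in> adj_rel (fan k) \<longleftrightarrow> i < k"
  by (auto simp: adj_rel_def edges_fan doubleton_eq_iff)

lemma adj_fan_Some_Some:
  "(Some i, Some j) \<in> adj_rel (fan k) \<longleftrightarrow> i < k \<and> j < k \<and> (j = Suc i \<or> i = Suc j)"
  by (auto simp: adj_rel_def edges_fan doubleton_eq_iff)

lemmas adj_fan = adj_fan_None_Some adj_fan_Some_None adj_fan_Some_Some

lemma graph_dist_fan_None_Some: "i < k \<Longrightarrow> graph_dist (fan k) None (Some i) = 1"
  by (rule graph_dist_eq_1) (simp add: adj_fan)

lemma graph_dist_fan_Some_None: "i < k \<Longrightarrow> graph_dist (fan k) (Some i) None = 1"
  by (rule graph_dist_eq_1) (simp add: adj_fan)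

text \<open>The hub joins any two path vertices by a walk of length two, which caps the
  distance.\<close>

lemma graph_dist_fan_Some_Some:
  assumes "i < k" "j < k"
  shows "graph_dist (fan k) (Some i) (Some j) =
    (if i = j then 0 else if j = Suc i \<or> i = Suc j then 1 else 2)"
  using assms
  by (auto simp: graph_dist_self adj_fan intro: graph_dist_eq_1[simplified] graph_dist_eq_2[of _ None])

section \<open>Moving a pile along the path\<close>

text \<open>A step from the pile towards the root turns the next occupied vertex into a pile of two;
  the induction is on the path distance to \<open>r\<close>. One of the two intervals is always
  empty, so their union is the open interval between \<open>i\<close> and \<open>r\<close> on either
  side.\<close>

lemma solvable_fan_chain:
  assumes "r < k" "i < k" "i \<noteq> r" "2 \<le> D (Some i)"
    and "\<And>j. j \<in> {i<..<r} \<union> {r<..<i} \<Longrightarrow> 1 \<le> D (Some j)"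
  shows "solvable (fan k) (Some r) D"
  using assms(2-)
proof (induction "nat \<bar>int i - int r\<bar>" arbitrary: i D rule: less_induct)
  case less
  define j where "j = (if i < r then Suc i else i - 1)"
  let ?E = "D(Some i := D (Some i) - 2, Some j := D (Some j) + 1)"
  have adj: "(Some i, Some j) \<in> adj_rel (fan k)"
    using less.prems \<open>r < k\<close> by (auto simp: adj_fan j_def)
  have "solvable (fan k) (Some r) ?E"
  proof (cases "j = r")
    case True
    then show ?thesis by (intro solvable_rootI) simp
  next
    case False
    have jb: "j \<in> {i<..<r} \<union> {r<..<i}"
      using False less.prems by (auto simp: j_def)
    show ?thesis
    proof (rule less.hyps)
      show "nat \<bar>int j - int r\<bar> < nat \<bar>int i - int r\<bar>" using jb by auto
      show "j < k" using jb \<open>r < k\<close> \<open>i < k\<close> by auto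
      show "j \<noteq> r" by fact
      show "2 \<le> ?E (Some j)" using less.prems(4)[OF jb] by simp
      show "1 \<le> ?E (Some l)" if "l \<in> {j<..<r} \<union> {r<..<j}" for l
        using that jb less.prems(4)[of l] by auto
    qed
  qed
  with adj less.prems(3) show ?case by (rule solvable_stepI)
qed

text \<open>A single pile of at most three pebbles allows one step. If the step ends on an empty
  vertex, no pile remains; if it ends on an occupied one, the pile has moved by one place along the
  path. It can therefore never get past the empty vertex \<open>g\<close>.\<close>

lemma not_solvable_fan_gap:
  assumes "D (Some i) \<le> 3" "\<And>x. x \<noteq> Some i \<Longrightarrow> D x \<le> 1" "D None = 0" "D (Some r) = 0"
    and "g \<in> {i<..<r} \<union> {r<..<i}" "D (Some g) = 0"
  shows "\<not> solvable (fan k) (Some r) D"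
proof
  \<comment> \<open>The invariant: either everything is frozen, or the only possible pile still lies
    behind the gap. Its position is quantified because it moves, while \<open>g\<close> and
    \<open>r\<close> stay fixed.\<close>
  define P where "P D \<longleftrightarrow> D (Some r) = 0 \<and> ((\<forall>x. D x \<le> 1) \<or>
    (\<exists>i. g \<in> {i<..<r} \<union> {r<..<i} \<and> D (Some i) \<le> 3 \<and> (\<forall>x. x \<noteq> Some i \<longrightarrow> D x \<le> 1)
        \<and> D None = 0 \<and> D (Some g) = 0))" for D :: "nat option \<Rightarrow> nat"
  assume "solvable (fan k) (Some r) D"
  then obtain D' where D': "(pebbling_step (fan k))\<^sup>*\<^sup>* D D'" "1 \<le> D' (Some r)"
    unfolding solvable_def by blast
  from D'(1) have "P D'"
  proof (induction rule: rtranclp_induct)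
    case base
    show ?case unfolding P_def using assms by blast
  next
    case (step E E')
    obtain a b where ab: "(a, b) \<in> adj_rel (fan k)" "2 \<le> E a"
      and E': "E' = E(a := E a - 2, b := E b + 1)"
      using step.hyps(2) unfolding pebbling_step_def by blast
    have "\<not> E a \<le> 1" using ab(2) by simp
    then obtain i where i: "g \<in> {i<..<r} \<union> {r<..<i}" "E (Some i) \<le> 3"
      "\<And>x. x \<noteq> Some i \<Longrightarrow> E x \<le> 1" "E None = 0" "E (Some g) = 0" and r0: "E (Some r) = 0"
      using step.IH unfolding P_def by blast
    have a: "a = Some i" using i(3)[of a] \<open>\<not> E a \<le> 1\<close> by blast
    have others: "E' x \<le> 1" if "x \<noteq> b" for x
      using that i(2) i(3)[of x] by (auto simp: E' a)
    show ?case
    proof (cases "E b = 0")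
      case True
      have "b \<noteq> Some r" using ab(1) i(1) by (auto simp: a adj_fan)
      then have "E' (Some r) = 0" using r0 ab(2) by (auto simp: E' a)
      moreover have "E' x \<le> 1" for x
        using others[of x] True by (cases "x = b") (auto simp: E')
      ultimately show ?thesis unfolding P_def by blast
    next
      case False
      then obtain j where b: "b = Some j" using i(4) by (cases b) auto
      have j: "j \<noteq> g" "j \<noteq> r" using False i(5) r0 by (auto simp: b)
      have ji: "j = Suc i \<or> i = Suc j" using ab(1) by (simp add: a b adj_fan)
      \<comment> \<open>A move by one place that does not land on \<open>g\<close> stays on the same
        side of \<open>g\<close>.\<close>
      have "g \<in> {j<..<r} \<union> {r<..<j}" using i(1) j ji by auto
      moreover have "E' (Some j) \<le> 3" using i(3)[of "Some j"] ji by (auto simp: E' b)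
      moreover have "E' None = 0" using i(4) by (simp add: E' a b)
      moreover have "E' (Some g) = 0" using i(1,5) j by (auto simp: E' a b)
      moreover have "E' (Some r) = 0" using i(1) r0 j by (auto simp: E' a b)
      ultimately show ?thesis using others unfolding P_def b by blast
    qed
  qed
  with D'(2) assms(4) show False unfolding P_def by simp
qed

section \<open>Critical distributions on the fan\<close>

text \<open>Every path vertex is adjacent to the hub, so a critical distribution is one pebble on
  the hub or two on a single path vertex; both have weight one.\<close>

lemma critical_fan_hub_bounds:
  assumes k: "4 \<le> k" and crit: "critical (fan k) None D"
  shows "dist_size (fan k) D \<le> k \<and> weight (fan k) None D \<le> (real k + 1) / 4"
proof (cases "1 \<le> D None")
  case True
  have "D = (\<lambda>_. 0)(None := 1)"
    by (rule critical_minimal[OF crit]) (use True in \<open>auto simp: le_fun_def intro: solvable_rootI\<close>)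
  then show ?thesis
    using k by (simp add: dist_size_fun_upd weight_fun_upd finite_verts_fan verts_fan
        dist_size_zero weight_zero graph_dist_self)
next
  case False
  have "\<exists>u. 2 \<le> D u"
  proof (rule ccontr)
    assume "\<nexists>u. 2 \<le> D u"
    then have "D u \<le> 1" for u by (metis not_less_eq_eq numeral_2_eq_2 One_nat_def)
    with False have "\<not> solvable (fan k) None D" by (intro not_solvable_of_le_one) auto
    with crit show False by (simp add: critical_def)
  qed
  then obtain u where u: "2 \<le> D u" by blast
  with False obtain i where i: "u = Some i" by (cases u) auto
  have ik: "i < k"
    using crit u by (force simp: critical_def distribution_def verts_fan i)
  have "solvable (fan k) None ((\<lambda>_. 0)(Some i := 2))"
    by (rule solvable_stepI[of "Some i" None]) (auto simp: adj_fan ik intro: solvable_rootI)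
  then have "D = (\<lambda>_. 0)(Some i := 2)"
    by (rule critical_minimal[OF crit]) (use u i in \<open>auto simp: le_fun_def\<close>)
  then show ?thesis
    using k ik by (simp add: dist_size_fun_upd weight_fun_upd finite_verts_fan verts_fan
        dist_size_zero weight_zero graph_dist_fan_Some_None)
qed

lemma critical_fan_path_bounds:
  assumes k: "4 \<le> k" and crit: "critical (fan k) (Some r) D"
  shows "dist_size (fan k) D \<le> k \<and> weight (fan k) (Some r) D \<le> (real k + 1) / 4"
proof -
  let ?G = "fan k" and ?r = "Some r" and ?O = "(\<lambda>_. 0) :: nat option \<Rightarrow> nat"
  note upd = dist_size_fun_upd weight_fun_upd finite_verts_fan verts_fan
    dist_size_zero weight_zero
  have rk: "r < k" using crit by (auto simp: critical_def verts_fan)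
  have sol: "solvable ?G ?r D" using crit by (simp add: critical_def)
  have minimal: "D = E" if "solvable ?G ?r E" "E \<le> D" for E
    using critical_minimal[OF crit that] .
  have supp: "i < k" if "0 < D (Some i)" for i
    using crit that by (force simp: critical_def distribution_def verts_fan)
  \<comment> \<open>This is where \<open>4 \<le> k\<close> enters: it gives both 4 \<le> k for the
    size and 1 \<le> (k + 1)/4 for the weight.\<close>
  have bound1: ?thesis if "dist_size ?G D \<le> 4" "weight ?G ?r D \<le> 1"
    using that k by simp

  \<comment> \<open>In the last case some vertex must still hold two pebbles, or no step would
    exist; it lies on the path because the hub is a neighbour of the root.\<close>
  consider (root) "1 \<le> D ?r"
    | (neighbour) u where "(u, ?r) \<in> adj_rel ?G" "2 \<le> D u"
    | (away) i where "D ?r = 0" "2 \<le> D (Some i)" "\<And>u. (u, ?r) \<in> adj_rel ?G \<Longrightarrow> D u \<le> 1"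
  proof (cases "1 \<le> D ?r \<or> (\<exists>u. (u, ?r) \<in> adj_rel ?G \<and> 2 \<le> D u)")
    case True
    then show ?thesis using root neighbour by blast
  next
    case False
    then have r0: "D ?r = 0" and nb: "\<And>u. (u, ?r) \<in> adj_rel ?G \<Longrightarrow> D u \<le> 1"
      by (auto simp: not_le less_Suc_eq_le numeral_2_eq_2)
    have "\<exists>u. \<not> D u \<le> 1" using not_solvable_of_le_one[of D] sol r0 by blast
    then obtain u where u: "\<not> D u \<le> 1" by blast
    moreover have "D None \<le> 1" using nb[of None] rk by (simp add: adj_fan)
    ultimately obtain i where "u = Some i" by (cases u) auto
    then show ?thesis using away[of i] r0 nb u by simp
  qed
  then show ?thesis
  proof cases
    case root
    have "D = ?O(?r := 1)"
      by (rule minimal) (use root in \<open>auto simp: le_fun_def intro: solvable_rootI\<close>)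
    then show ?thesis
      using rk by (intro bound1) (simp_all add: upd graph_dist_self)
  next
    case (neighbour u)
    have "u \<noteq> ?r" using neighbour(1) by (auto simp: adj_rel_def)
    have uv: "u \<in> verts ?G" using neighbour(1) by (cases u) (auto simp: adj_fan verts_fan)
    have "solvable ?G ?r (?O(u := 2))"
      using neighbour(1) by (rule solvable_stepI) (auto intro: solvable_rootI)
    then have D: "D = ?O(u := 2)"
      by (rule minimal) (use neighbour in \<open>auto simp: le_fun_def\<close>)
    have "dist_size ?G D = 2" "weight ?G ?r D = 1"
      using uv unfolding D
      by (subst dist_size_fun_upd weight_fun_upd;
          simp add: finite_verts_fan dist_size_zero weight_zero graph_dist_eq_1[OF neighbour(1)])+
    then show ?thesis by (intro bound1) simp_all
  next
    case (away i)
    have ik: "i < k" using supp away(2) by simp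
    \<comment> \<open>Such a vertex is neither the root nor a neighbour of it, so it has distance
      two and each of its pebbles has weight 1/4.\<close>
    have far: "j \<noteq> r \<and> j \<noteq> Suc r \<and> r \<noteq> Suc j \<and> j < k" if "2 \<le> D (Some j)" for j
    proof -
      have "j < k" using supp that by simp
      moreover have "(Some j, ?r) \<notin> adj_rel ?G" using away(3)[of "Some j"] that by auto
      moreover have "j \<noteq> r" using away(1) that by auto
      ultimately show ?thesis using rk by (auto simp: adj_fan)
    qed
    note fari = far[OF away(2)]
    have toHub: "(Some j, None) \<in> adj_rel ?G" if "j < k" for j using that by (simp add: adj_fan)
    have hubRoot: "(None, ?r) \<in> adj_rel ?G" using rk by (simp add: adj_fan)
    \<comment> \<open>In the first three cases two pebbles can be gathered on the hub, one step from
      the root. In the fourth, a single pile of at most three can send only one pebble to the empty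
      hub.\<close>
    consider (hub) "1 \<le> D None" | (four) "4 \<le> D (Some i)"
      | (two) j where "j \<noteq> i" "2 \<le> D (Some j)"
      | (chain) "D None = 0" "D (Some i) \<le> 3" "\<And>x. x \<noteq> Some i \<Longrightarrow> D x \<le> 1"
    proof (cases "1 \<le> D None \<or> 4 \<le> D (Some i) \<or> (\<exists>j. j \<noteq> i \<and> 2 \<le> D (Some j))")
      case True
      then show ?thesis using hub four two by blast
    next
      case False
      have "D x \<le> 1" if "x \<noteq> Some i" for x
        using False that by (cases x) (auto simp: not_le less_Suc_eq_le numeral_2_eq_2)
      then show ?thesis using chain False by simp
    qed
    then show ?thesis
    proof cases
      case hub
      have "solvable ?G ?r (?O(Some i := 2, None := 1))"
        by (rule solvable_stepI[OF toHub[OF ik]], simp, rule solvable_stepI[OF hubRoot])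
          (auto intro: solvable_rootI)
      then have "D = ?O(Some i := 2, None := 1)"
        by (rule minimal) (use away hub in \<open>auto simp: le_fun_def\<close>)
      then show ?thesis
        using rk fari by (intro bound1)
          (simp_all add: upd graph_dist_fan_None_Some graph_dist_fan_Some_Some)
    next
      case four
      have "solvable ?G ?r (?O(Some i := 4))"
        by (rule solvable_stepI[OF toHub[OF ik]], simp, rule solvable_stepI[OF toHub[OF ik]], simp,
            rule solvable_stepI[OF hubRoot])
          (auto intro: solvable_rootI)
      then have "D = ?O(Some i := 4)"
        by (rule minimal) (use four in \<open>auto simp: le_fun_def\<close>)
      then show ?thesis
        using rk fari by (intro bound1) (simp_all add: upd graph_dist_fan_Some_Some)
    next
      case (two j)
      note farj = far[OF two(2)]
      have jk: "j < k" using farj by simp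
      have "solvable ?G ?r (?O(Some i := 2, Some j := 2))"
        by (rule solvable_stepI[OF toHub[OF ik]], use two(1) in simp,
            rule solvable_stepI[OF toHub[OF jk]], use two(1) in simp,
            rule solvable_stepI[OF hubRoot])
          (use two(1) in \<open>auto intro: solvable_rootI\<close>)
      then have "D = ?O(Some i := 2, Some j := 2)"
        by (rule minimal) (use away two in \<open>auto simp: le_fun_def\<close>)
      then show ?thesis
        using rk fari farj two(1) by (intro bound1)
          (simp_all add: upd graph_dist_fan_Some_Some)
    next
      case chain
      let ?B = "{i<..<r} \<union> {r<..<i}"
      \<comment> \<open>The shortest chain from \<open>i\<close> to the root. A gap would make
        \<open>D\<close> unsolvable, so \<open>E\<close> lies below \<open>D\<close>, and minimality
        forces equality.\<close>
      define E where "E = (\<lambda>x. case x of None \<Rightarrow> 0 |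
          Some j \<Rightarrow> if j = i then 2 else if j \<in> ?B then 1 else (0::nat))"
      have B: "1 \<le> D (Some j)" if "j \<in> ?B" for j
      proof (rule ccontr)
        assume "\<not> 1 \<le> D (Some j)"
        then have "\<not> solvable ?G ?r D"
          using chain away(1) that by (intro not_solvable_fan_gap[of D i r j]) auto
        with sol show False by contradiction
      qed
      have "solvable ?G ?r E"
        by (rule solvable_fan_chain[of r k i]) (use rk fari in \<open>auto simp: E_def\<close>)
      then have D: "D = E"
        by (rule minimal) (use B away(2) in \<open>auto simp: le_fun_def E_def split: option.split\<close>)
      \<comment> \<open>The neighbour of the root on the side of \<open>i\<close>: the only chain
        vertex at distance one, where a pebble weighs 1/2 instead of 1/4.\<close>
      define n where "n = (if i < r then r - 1 else Suc r)"
      have nk: "n < k" and ni: "n \<noteq> i" and nr: "n \<noteq> r" using rk fari by (auto simp: n_def)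
      \<comment> \<open>One pebble per path vertex, one more at the pile, one less at the root. The
        count is over \<open>int\<close> because subtraction on \<open>nat\<close>
        truncates.\<close>
      have "int (\<Sum>j<k. E (Some j)) \<le> (\<Sum>j<k. 1 + of_bool (j = i) - of_bool (j = r))"
        unfolding of_nat_sum by (rule sum_mono) (use fari in \<open>auto simp: E_def\<close>)
      also have "\<dots> = int k"
        using ik rk by (simp add: sum.distrib sum_subtractf of_bool_def)
      finally have size: "dist_size ?G D \<le> k"
        by (simp add: dist_size_def sum_verts_fan D E_def del: of_nat_sum)
      \<comment> \<open>A quarter per path vertex, a further quarter each for the pile
        \<open>i\<close> and for \<open>n\<close>, and a quarter less for the empty root.\<close>
      have "(\<Sum>j<k. real (E (Some j)) / 2 ^ graph_dist ?G (Some j) ?r)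
          \<le> (\<Sum>j<k. 1 / 4 + of_bool (j = i) / 4 + of_bool (j = n) / 4 - of_bool (j = r) / 4)"
        by (rule sum_mono)
          (use rk fari ni nr in \<open>auto simp: E_def graph_dist_fan_Some_Some n_def\<close>)
      also have "\<dots> = (real k + 1) / 4"
        using ik rk nk
        by (simp add: sum.distrib sum_subtractf of_bool_def add_divide_distrib
            flip: sum_divide_distrib)
      finally have "weight ?G ?r D \<le> (real k + 1) / 4"
        by (simp add: weight_def sum_verts_fan D E_def)
      with size show ?thesis by simp
    qed
  qed
qed

lemma critical_fan_bounds:
  assumes "4 \<le> k" "critical (fan k) r D"
  shows "dist_size (fan k) D \<le> k" "weight (fan k) r D \<le> (real k + 1) / 4"
  using assms critical_fan_hub_bounds critical_fan_path_bounds by (cases r; blast)+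

section \<open>The extremal chain\<close>

text \<open>The chain running from the end \<open>k - 1\<close> of the path to the root at the other
  end. The value 0 for \<open>k \<le> j\<close> makes it vanish off the fan, as
  \<open>distribution\<close> demands.\<close>

definition fan_chain :: "nat \<Rightarrow> nat option \<Rightarrow> nat" where
  "fan_chain k x = (case x of None \<Rightarrow> 0 |
     Some j \<Rightarrow> if j = 0 \<or> k \<le> j then 0 else if j = k - 1 then 2 else 1)"

text \<open>Taking a pebble from the pile leaves no vertex with two; taking one from any other
  occupied vertex opens a gap between the pile and the root.\<close>

lemma critical_fan_chain:
  assumes k: "4 \<le> k"
  shows "critical (fan k) (Some 0) (fan_chain k)"
  unfolding critical_def
proof (intro conjI allI impI)
  show "Some 0 \<in> verts (fan k)" using k by (simp add: verts_fan)
  show "distribution (fan k) (fan_chain k)"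
    by (auto simp: distribution_def verts_fan fan_chain_def split: option.split)
  show "solvable (fan k) (Some 0) (fan_chain k)"
    by (rule solvable_fan_chain[of 0 k "k - 1"]) (use k in \<open>auto simp: fan_chain_def\<close>)
  fix v assume "0 < fan_chain k v"
  then obtain j where v: "v = Some j" and j: "0 < j" "j < k"
    by (auto simp: fan_chain_def split: option.splits if_splits)
  let ?D = "(fan_chain k)(v := fan_chain k v - 1)"
  show "\<not> solvable (fan k) (Some 0) ?D"
  proof (cases "j = k - 1")
    case True
    then show ?thesis
      using k by (intro not_solvable_of_le_one)
        (auto simp: v fan_chain_def split: option.split)
  next
    case False
    then show ?thesis
      using j k by (intro not_solvable_fan_gap[of _ "k - 1" _ j])
        (auto simp: v fan_chain_def split: option.split)
  qed
qed

lemma dist_size_fan_chain: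
  assumes "4 \<le> k"
  shows "dist_size (fan k) (fan_chain k) = k"
proof -
  have "int (\<Sum>j<k. fan_chain k (Some j)) = (\<Sum>j<k. 1 + of_bool (j = k - 1) - of_bool (j = 0))"
    unfolding of_nat_sum by (rule sum.cong) (use assms in \<open>auto simp: fan_chain_def\<close>)
  also have "\<dots> = int k"
    using assms by (simp add: sum.distrib sum_subtractf of_bool_def)
  finally show ?thesis
    by (simp add: dist_size_def sum_verts_fan fan_chain_def[of _ None] del: of_nat_sum)
qed

text \<open>The termwise estimate for chains becomes an equality, with the pile at
  \<open>k - 1\<close>, the root at 0 and its neighbour at 1.\<close>

lemma weight_fan_chain:
  assumes "4 \<le> k"
  shows "weight (fan k) (Some 0) (fan_chain k) = (real k + 1) / 4"
proof -
  have "(\<Sum>j<k. real (fan_chain k (Some j)) / 2 ^ graph_dist (fan k) (Some j) (Some 0))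
      = (\<Sum>j<k. 1 / 4 + of_bool (j = k - 1) / 4 + of_bool (j = 1) / 4 - of_bool (j = 0) / 4)"
    by (rule sum.cong) (use assms in \<open>auto simp: fan_chain_def graph_dist_fan_Some_Some\<close>)
  also have "\<dots> = (real k + 1) / 4"
    using assms
    by (simp add: sum.distrib sum_subtractf of_bool_def add_divide_distrib
        flip: sum_divide_distrib)
  finally show ?thesis
    by (simp add: weight_def sum_verts_fan fan_chain_def[of _ None])
qed

section \<open>Evaluating the two maxima\<close>

lemma critical_number_fan:
  assumes "4 \<le> k"
  shows "critical_number (fan k) = k"
  unfolding critical_number_def
proof (rule Max_eqI)
  have sub: "{dist_size (fan k) D | r D. critical (fan k) r D} \<subseteq> {..k}"
    using critical_fan_bounds(1)[OF assms] by blast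
  then show "finite {dist_size (fan k) D | r D. critical (fan k) r D}"
    by (rule finite_subset) simp
  show "n \<le> k" if "n \<in> {dist_size (fan k) D | r D. critical (fan k) r D}" for n
    using sub that by blast
  show "k \<in> {dist_size (fan k) D | r D. critical (fan k) r D}"
    using critical_fan_chain[OF assms] dist_size_fan_chain[OF assms] by force
qed

text \<open>Needed for \<open>Max\<close> to be meaningful: the size bound limits every entry to at
  most \<open>k\<close>, and entries vanish off a finite vertex set.\<close>

lemma finite_critical_fan:
  assumes "4 \<le> k"
  shows "finite {(r, D). critical (fan k) r D}"
proof -
  let ?F = "{D. \<forall>x. (x \<in> verts (fan k) \<longrightarrow> D x \<in> {..k}) \<and> (x \<notin> verts (fan k) \<longrightarrow> D x = 0)}"
  have "D x \<le> k" if "critical (fan k) r D" "x \<in> verts (fan k)" for r D x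
    using critical_fan_bounds(1)[OF assms that(1)] member_le_sum[OF that(2), of D]
    by (simp add: dist_size_def finite_verts_fan)
  then have "{(r, D). critical (fan k) r D} \<subseteq> verts (fan k) \<times> ?F"
    by (auto simp: critical_def distribution_def)
  moreover have "finite (verts (fan k) \<times> ?F)"
    by (intro finite_cartesian_product finite_set_of_finite_funs finite_verts_fan finite_atMost)
  ultimately show ?thesis by (rule finite_subset)
qed

theorem theorem26:
  fixes k :: nat
  assumes "4 \<le> k"
  shows "graph_weight (fan k) = (real k + 1) / 4"
  unfolding graph_weight_def
proof (rule Max_eqI)
  let ?W = "{weight (fan k) r D | r D. ceiling_distribution (fan k) r D}"
  have "?W \<subseteq> (\<lambda>(r, D). weight (fan k) r D) ` {(r, D). critical (fan k) r D}"
    by (auto simp: ceiling_distribution_def)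
  then show "finite ?W"
    using finite_critical_fan[OF assms] finite_surj by blast
  show "w \<le> (real k + 1) / 4" if "w \<in> ?W" for w
    using that critical_fan_bounds(2)[OF assms] by (auto simp: ceiling_distribution_def)
  have "ceiling_distribution (fan k) (Some 0) (fan_chain k)"
    using assms by (simp add: ceiling_distribution_def critical_fan_chain dist_size_fan_chain
        critical_number_fan)
  then show "(real k + 1) / 4 \<in> ?W"
    using weight_fan_chain[OF assms] by force
qed

end
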